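(* Let $\mathbb{K}$ be a field of characteristic different from $2$ and let $\Delta\in\mathbb{K}$ be a non-square. The set $\mathrm{Cl}_{\mathbb{K}}(\Delta)$ of $\mathrm{PSL}_2(\mathbb{K})$-orbits of binary quadratic forms over $\mathbb{K}$ of discriminant $\Delta$ embeds into the group $\mathbb{K}^\times/\mathrm{N}_{\mathbb{K}}(\mathbb{K}[\sqrt\Delta]^\times)$ of exponent two, by sending the class of the norm form $x^2-\tfrac{\Delta}{4}y^2$ of the extension $\mathbb{K}[\sqrt\Delta]$ to the identity, and using the multiplication of values for composition. That is: the map sending the orbit of $Q$ to the class of $Q(v)$, for any $v\in\mathbb{K}^2\setminus\{0\}$, is well defined and injective, it sends the orbit of $x^2-\tfrac{\Delta}{4}y^2$ to the identity, and multiplication of values (the product of the orbits of $Q_a$ and $Q_b$ being the orbit whose values lie in the class of $Q_a(u)Q_b(v)$, for nonzero $u,v\in\mathbb{K}^2$) defines a group law on $\mathrm{Cl}_{\mathbb{K}}(\Delta)$ for which this map is an injective group homomorphism.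
   Context: A binary quadratic form over $\mathbb{K}$ is $Q=lx^2+mxy+ry^2$ with $l,m,r\in\mathbb{K}$; its discriminant is $m^2-4lr\in\mathbb{K}$. The group $\mathrm{PSL}_2(\mathbb{K})$ acts on such forms by linear change of variables. $\mathrm{N}_{\mathbb{K}}(\mathbb{K}[\sqrt\Delta]^\times)$ is the group of norms of nonzero elements of the quadratic field extension $\mathbb{K}[\sqrt\Delta]$, where $\mathrm{N}_{\mathbb{K}}(x+y\sqrt\Delta)=x^2-\Delta y^2$. *)

theory Defs
  imports "HOL-Analysis.Determinants" "HOL-Algebra.Group_Action" "HOL-Algebra.Ring"
begin

section \<open>Binary quadratic forms\<close>

text \<open>\<open>BQF l m r\<close> is the form $l x^2 + m x y + r y^2$.\<close>

datatype 'a bqf = BQF 'a 'a 'a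

fun bqf_eval :: "'a::field bqf \<Rightarrow> 'a^2 \<Rightarrow> 'a" where
  "bqf_eval (BQF l m r) v = l * (v$1)^2 + m * v$1 * v$2 + r * (v$2)^2"

fun bqf_disc :: "'a::field bqf \<Rightarrow> 'a" where
  "bqf_disc (BQF l m r) = m^2 - 4 * l * r"

definition bqf_of_disc :: "'a::field \<Rightarrow> 'a bqf set" where
  "bqf_of_disc \<Delta> = {Q. bqf_disc Q = \<Delta>}"

definition norm_form :: "'a::field \<Rightarrow> 'a bqf" where
  "norm_form \<Delta> = BQF 1 0 (- (\<Delta> / 4))"

text \<open>Coefficients of $Q \circ B$; see \<open>bqf_eval_subst\<close> below.\<close>

fun bqf_subst :: "'a::field bqf \<Rightarrow> 'a^2^2 \<Rightarrow> 'a bqf" where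
  "bqf_subst (BQF l m r) B =
     BQF (l * (B$1$1)^2 + m * B$1$1 * B$2$1 + r * (B$2$1)^2)
         (2 * l * B$1$1 * B$1$2 + m * (B$1$1 * B$2$2 + B$1$2 * B$2$1) + 2 * r * B$2$1 * B$2$2)
         (l * (B$1$2)^2 + m * B$1$2 * B$2$2 + r * (B$2$2)^2)"

lemma bqf_eval_subst: "bqf_eval (bqf_subst Q B) v = bqf_eval Q (B *v v)"
  by (cases Q) (simp add: matrix_vector_mult_def sum_2 power2_eq_square algebra_simps)

lemma bqf_disc_subst: "bqf_disc (bqf_subst Q B) = (det B)^2 * bqf_disc Q"
  by (cases Q) (simp add: det_2 power2_eq_square algebra_simps)

lemma bqf_subst_one: "bqf_subst Q (mat 1) = Q"
  by (cases Q) (simp add: mat_def)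

lemma bqf_subst_mult: "bqf_subst (bqf_subst Q A) B = bqf_subst Q (A ** B)"
  by (cases Q) (simp add: matrix_matrix_mult_def sum_2 power2_eq_square algebra_simps)

lemma bqf_subst_minus: "bqf_subst Q (- B) = bqf_subst Q B"
  by (cases Q) simp


section \<open>The action of $\mathrm{PSL}_2$\<close>

definition SL2 :: "('a::field^2^2) monoid" where
  "SL2 = \<lparr>carrier = {A. det A = 1}, mult = (**), one = mat 1\<rparr>"

definition PSL2 :: "('a::field^2^2) set monoid" where
  "PSL2 = SL2 Mod {mat 1, - mat 1}"

text \<open>The left action $A \cdot Q = Q \circ A^{-1}$.\<close>

definition sl_act :: "'a::field^2^2 \<Rightarrow> 'a bqf \<Rightarrow> 'a bqf" where
  "sl_act A Q = bqf_subst Q (matrix_inv A)"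

definition psl_act :: "('a::field^2^2) set \<Rightarrow> 'a bqf \<Rightarrow> 'a bqf" where
  "psl_act C Q = the_elem ((\<lambda>A. sl_act A Q) ` C)"

definition Cl :: "'a::field \<Rightarrow> 'a bqf set set" where
  "Cl \<Delta> = orbits PSL2 (bqf_of_disc \<Delta>) psl_act"

definition form_class :: "'a::field bqf \<Rightarrow> 'a bqf set" where
  "form_class Q = orbit PSL2 psl_act Q"

lemma sl_inverse:
  fixes A :: "'a::field^2^2"
  assumes "det A = 1"
  shows "A ** matrix_inv A = mat 1" "matrix_inv A ** A = mat 1"
proof -
  let ?B = "(\<chi> i j. if i = j then (if i = 1 then A$2$2 else A$1$1) else - A$i$j) :: 'a^2^2"
  have "A ** ?B = mat 1 \<and> ?B ** A = mat 1"
    using assms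
    by (simp add: vec_eq_iff forall_2 matrix_matrix_mult_def sum_2 mat_def det_2 algebra_simps)
  then have "\<exists>B. A ** B = mat 1 \<and> B ** A = mat 1" by blast
  then have "A ** matrix_inv A = mat 1 \<and> matrix_inv A ** A = mat 1"
    unfolding matrix_inv_def by (rule someI_ex)
  then show "A ** matrix_inv A = mat 1" "matrix_inv A ** A = mat 1" by auto
qed

lemma sl_inverse_unique:
  fixes A :: "'a::field^2^2"
  assumes "det A = 1" "A ** B = mat 1"
  shows "matrix_inv A = B"
  by (metis assms sl_inverse(2) matrix_mul_assoc matrix_mul_lid matrix_mul_rid)

lemma sl_act_minus:
  fixes A :: "'a::field^2^2"
  assumes "det A = 1"
  shows "sl_act (- A) Q = sl_act A Q"
proof -
  have "(- A) ** (- matrix_inv A) = A ** matrix_inv A"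
    by (simp add: matrix_matrix_mult_def)
  moreover have "det (- A) = 1" using assms by (simp add: det_2)
  ultimately have "matrix_inv (- A) = - matrix_inv A"
    using sl_inverse[OF assms] by (intro sl_inverse_unique) auto
  then show ?thesis by (simp add: sl_act_def bqf_subst_minus)
qed

lemma psl_act_coset:
  fixes A :: "'a::field^2^2"
  assumes "A \<in> carrier SL2"
  shows "psl_act ({mat 1, - mat 1} #>\<^bsub>SL2\<^esub> A) Q = sl_act A Q"
proof -
  have "(- mat 1) ** A = - A"
    by (simp add: vec_eq_iff forall_2 matrix_matrix_mult_def sum_2 mat_def)
  then have "{mat 1, - mat 1} #>\<^bsub>SL2\<^esub> A = {A, - A}"
    by (auto simp: r_coset_def SL2_def)
  then show ?thesis
    using assms by (simp add: psl_act_def sl_act_minus SL2_def)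
qed

lemma sl_act_one: "sl_act (mat 1) (Q :: 'a::field bqf) = Q"
  using sl_inverse_unique[of "mat 1 :: 'a^2^2" "mat 1"] by (simp add: sl_act_def bqf_subst_one)

lemma sl_act_mult:
  fixes A B :: "'a::field^2^2"
  assumes "det A = 1" "det B = 1"
  shows "sl_act (A ** B) Q = sl_act A (sl_act B Q)"
proof -
  have "(A ** B) ** (matrix_inv B ** matrix_inv A) = mat 1"
    by (metis assms sl_inverse(1) matrix_mul_assoc matrix_mul_rid)
  then have "matrix_inv (A ** B) = matrix_inv B ** matrix_inv A"
    using assms by (intro sl_inverse_unique) (auto simp: det_mul)
  then show ?thesis by (simp add: sl_act_def bqf_subst_mult)
qed

lemma bqf_disc_sl_act:
  assumes "det A = 1"
  shows "bqf_disc (sl_act A Q) = bqf_disc Q"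
proof -
  have "det (matrix_inv A) = 1"
    using sl_inverse(1)[OF assms] assms by (metis det_mul det_I mult_1)
  then show ?thesis by (simp add: sl_act_def bqf_disc_subst)
qed


section \<open>Norms from the quadratic extension\<close>

text \<open>The pair \<open>(x, y)\<close> stands for $x + y\sqrt\Delta$.\<close>

definition quad_ext :: "'a::field \<Rightarrow> ('a \<times> 'a) ring" where
  "quad_ext \<Delta> =
     \<lparr>carrier = UNIV,
      mult = (\<lambda>(x, y) (x', y'). (x * x' + \<Delta> * y * y', x * y' + y * x')),
      one = (1, 0),
      zero = (0, 0),
      add = (\<lambda>(x, y) (x', y'). (x + x', y + y'))\<rparr>"

fun quad_norm :: "'a::field \<Rightarrow> 'a \<times> 'a \<Rightarrow> 'a" where
  "quad_norm \<Delta> (x, y) = x^2 - \<Delta> * y^2"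

definition norm_group :: "'a::field \<Rightarrow> 'a set" where
  "norm_group \<Delta> = quad_norm \<Delta> ` (carrier (quad_ext \<Delta>) - {\<zero>\<^bsub>quad_ext \<Delta>\<^esub>})"

definition mult_grp :: "'a::field monoid" where
  "mult_grp = \<lparr>carrier = UNIV - {0}, mult = (*), one = 1\<rparr>"

definition norm_quotient :: "'a::field \<Rightarrow> 'a set monoid" where
  "norm_quotient \<Delta> = mult_grp Mod norm_group \<Delta>"

definition norm_residue :: "'a::field \<Rightarrow> 'a \<Rightarrow> 'a set" where
  "norm_residue \<Delta> a = norm_group \<Delta> #>\<^bsub>mult_grp\<^esub> a"

lemma quad_norm_eq_0_iff:
  assumes "\<nexists>d. \<Delta> = d^2"
  shows "quad_norm \<Delta> z = 0 \<longleftrightarrow> z = (0, 0)"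
proof (cases z)
  case (Pair x y)
  have "y = 0" if "x^2 = \<Delta> * y^2"
  proof (rule ccontr)
    assume "y \<noteq> 0"
    with that have "\<Delta> = (x / y)^2" by (simp add: field_simps)
    with assms show False by blast
  qed
  with Pair show ?thesis by auto
qed

lemma quad_ext_field:
  assumes "\<nexists>d. \<Delta> = d^2"
  shows "field (quad_ext \<Delta>)"
proof -
  have "cring (quad_ext \<Delta>)"
  proof (rule cringI)
    show "abelian_group (quad_ext \<Delta>)"
    proof (rule abelian_groupI)
      fix z assume "z \<in> carrier (quad_ext \<Delta>)"
      show "\<exists>w\<in>carrier (quad_ext \<Delta>). w \<oplus>\<^bsub>quad_ext \<Delta>\<^esub> z = \<zero>\<^bsub>quad_ext \<Delta>\<^esub>"
        by (rule bexI[of _ "(- fst z, - snd z)"]) (auto simp: quad_ext_def split: prod.splits)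
    qed (auto simp: quad_ext_def)
    show "comm_monoid (quad_ext \<Delta>)"
      by (rule comm_monoidI) (auto simp: quad_ext_def algebra_simps)
  qed (auto simp: quad_ext_def algebra_simps)
  then show ?thesis
  proof (rule cring.cring_fieldI2)
    show "\<zero>\<^bsub>quad_ext \<Delta>\<^esub> \<noteq> \<one>\<^bsub>quad_ext \<Delta>\<^esub>" by (simp add: quad_ext_def)
    fix z assume "z \<in> carrier (quad_ext \<Delta>)" "z \<noteq> \<zero>\<^bsub>quad_ext \<Delta>\<^esub>"
    then obtain x y where z: "z = (x, y)" "(x, y) \<noteq> (0, 0)"
      by (cases z) (auto simp: quad_ext_def)
    define n where "n = quad_norm \<Delta> z"
    have "n \<noteq> 0" using z quad_norm_eq_0_iff[OF assms] by (auto simp: n_def)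
    moreover have "x * x - \<Delta> * y * y = n" by (simp add: n_def z power2_eq_square)
    ultimately show "\<exists>w\<in>carrier (quad_ext \<Delta>). z \<otimes>\<^bsub>quad_ext \<Delta>\<^esub> w = \<one>\<^bsub>quad_ext \<Delta>\<^esub>"
      by (intro bexI[of _ "(x / n, - y / n)"])
         (auto simp: quad_ext_def z field_simps)
  qed
qed


section \<open>The value map and the composition of classes\<close>

definition value_class :: "'a::field \<Rightarrow> 'a bqf set \<Rightarrow> 'a set" where
  "value_class \<Delta> \<O> = the_elem {norm_residue \<Delta> (bqf_eval Q v) | Q v. Q \<in> \<O> \<and> v \<noteq> 0}"

definition is_product :: "'a::field \<Rightarrow> 'a bqf set \<Rightarrow> 'a bqf set \<Rightarrow> 'a bqf set \<Rightarrow> bool" where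
  "is_product \<Delta> \<A> \<B> \<C> \<longleftrightarrow>
     (\<forall>Qa\<in>\<A>. \<forall>Qb\<in>\<B>. \<forall>Q\<in>\<C>. \<forall>u v w. u \<noteq> 0 \<longrightarrow> v \<noteq> 0 \<longrightarrow> w \<noteq> 0 \<longrightarrow>
        norm_residue \<Delta> (bqf_eval Q w) = norm_residue \<Delta> (bqf_eval Qa u * bqf_eval Qb v))"

definition Cl_group :: "'a::field \<Rightarrow> 'a bqf set monoid" where
  "Cl_group \<Delta> =
     \<lparr>carrier = Cl \<Delta>,
      mult = (\<lambda>\<A> \<B>. THE \<C>. \<C> \<in> Cl \<Delta> \<and> is_product \<Delta> \<A> \<B> \<C>),
      one = form_class (norm_form \<Delta>)\<rparr>"

end

theory Submission
  imports Defs
begin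

text \<open>
  Everything rests on completing the square. For \<open>Q = l x\<^sup>2 + m x y + r y\<^sup>2\<close> of non-square
  discriminant \<open>\<Delta>\<close> the coefficient \<open>l\<close> is nonzero, and
  \<open>Q(x, y) = l \<cdot> N (x + m y / (2 l) + (y / (2 l)) sqrt \<Delta>)\<close>, where the argument of the norm
  runs bijectively over \<open>K[sqrt \<Delta>]\<close>. The set of values of \<open>Q\<close> at nonzero vectors is therefore
  exactly one coset of the norm group, the coset of \<open>l\<close> (\<open>bqf_values_eq_norm_residue\<close>). Since an
  invertible substitution does not change the set of values, the coset depends only on the orbit.

  For injectivity, let \<open>Q\<close> and \<open>Q'\<close> have the same coset. Then the leading coefficient of \<open>Q'\<close> is a
  value \<open>Q(v)\<close>. Completing \<open>v\<close> to a matrix of determinant one moves \<open>Q\<close> within its orbit to a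
  form with that leading coefficient, and two forms with the same leading coefficient and the same
  discriminant differ by a shear (\<open>form_class_eqI\<close>).

  The map is also onto, as \<open>a x\<^sup>2 - (\<Delta> / (4 a)) y\<^sup>2\<close> has discriminant \<open>\<Delta>\<close> and the value \<open>a\<close>. So the
  orbits are in bijection with the cosets, composition of orbits is the multiplication of cosets
  carried over by this bijection, and the group axioms are inherited. The exponent of the quotient
  divides two because a square is the norm of an element of \<open>K\<close>.
\<close>

section \<open>The norm group and its cosets\<close>

lemma mult_grp_simps [simp]:
  "carrier mult_grp = UNIV - {0}" "x \<otimes>\<^bsub>mult_grp\<^esub> y = x * y" "\<one>\<^bsub>mult_grp\<^esub> = 1"
  by (simp_all add: mult_grp_def)

lemma comm_group_mult_grp: "comm_group (mult_grp :: 'a::field monoid)"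
proof (rule comm_groupI)
  fix x :: 'a assume "x \<in> carrier mult_grp"
  then show "\<exists>y\<in>carrier mult_grp. y \<otimes>\<^bsub>mult_grp\<^esub> x = \<one>\<^bsub>mult_grp\<^esub>"
    by (intro bexI[of _ "inverse x"]) auto
qed auto

lemma norm_group_iff:
  "n \<in> norm_group \<Delta> \<longleftrightarrow> (\<exists>s t. (s, t) \<noteq> (0, 0) \<and> n = s^2 - \<Delta> * t^2)"
proof -
  have "norm_group \<Delta> = {s^2 - \<Delta> * t^2 | s t. (s, t) \<noteq> (0, 0)}"
    by (force simp: norm_group_def quad_ext_def)
  then show ?thesis by blast
qed

lemma square_in_norm_group:
  assumes "a \<noteq> 0"
  shows "a^2 \<in> norm_group \<Delta>"
  unfolding norm_group_iff using assms by (intro exI[of _ a] exI[of _ 0]) auto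

lemma norm_group_mult:
  assumes "\<nexists>d. \<Delta> = d^2" and "a \<in> norm_group \<Delta>" "b \<in> norm_group \<Delta>"
  shows "a * b \<in> norm_group \<Delta>"
proof -
  obtain s t where a: "(s, t) \<noteq> (0, 0)" "a = s^2 - \<Delta> * t^2"
    using assms(2) by (auto simp: norm_group_iff)
  obtain s' t' where b: "(s', t') \<noteq> (0, 0)" "b = s'^2 - \<Delta> * t'^2"
    using assms(3) by (auto simp: norm_group_iff)
  define p where "p = s * s' + \<Delta> * t * t'"
  define q where "q = s * t' + t * s'"
  have ab: "a * b = p^2 - \<Delta> * q^2"
    unfolding a b p_def q_def by (simp add: power2_eq_square algebra_simps)
  have "a \<noteq> 0" "b \<noteq> 0"
    using a b quad_norm_eq_0_iff[OF assms(1), of "(s, t)"]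
      quad_norm_eq_0_iff[OF assms(1), of "(s', t')"] by auto
  then have "p^2 - \<Delta> * q^2 \<noteq> 0" using ab by (metis mult_eq_0_iff)
  then have "(p, q) \<noteq> (0, 0)" by auto
  with ab show ?thesis unfolding norm_group_iff by blast
qed

lemma norm_group_nonzero:
  assumes "\<nexists>d. \<Delta> = d^2" and "a \<in> norm_group \<Delta>"
  shows "a \<noteq> 0"
  using assms quad_norm_eq_0_iff[OF assms(1)] by (auto simp: norm_group_def quad_ext_def)

text \<open>Inverses cost nothing: \<open>1/a = a \<cdot> (1/a)\<^sup>2\<close> is a norm times a square.\<close>

lemma norm_group_normal:
  assumes "\<nexists>d. \<Delta> = d^2"
  shows "norm_group \<Delta> \<lhd> mult_grp"
proof -
  interpret comm_group "mult_grp :: 'a monoid" by (rule comm_group_mult_grp)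
  have "subgroup (norm_group \<Delta>) mult_grp"
  proof (rule subgroupI)
    show "norm_group \<Delta> \<subseteq> carrier mult_grp" using norm_group_nonzero[OF assms] by auto
    show "norm_group \<Delta> \<noteq> {}" using square_in_norm_group[of 1 \<Delta>] by auto
  next
    fix a assume a: "a \<in> norm_group \<Delta>"
    have "a \<noteq> 0" using norm_group_nonzero[OF assms a] .
    then have "inv\<^bsub>mult_grp\<^esub> a = inverse a" by (intro inv_equality) auto
    also have "\<dots> = a * (inverse a)^2" using \<open>a \<noteq> 0\<close> by (simp add: power2_eq_square)
    finally show "inv\<^bsub>mult_grp\<^esub> a \<in> norm_group \<Delta>"
      using norm_group_mult[OF assms a square_in_norm_group[of "inverse a"]] \<open>a \<noteq> 0\<close> by simp
  next
    fix a b assume "a \<in> norm_group \<Delta>" "b \<in> norm_group \<Delta>"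
    then show "a \<otimes>\<^bsub>mult_grp\<^esub> b \<in> norm_group \<Delta>" using norm_group_mult[OF assms] by simp
  qed
  then show ?thesis by (rule subgroup_imp_normal)
qed

lemma group_norm_quotient:
  assumes "\<nexists>d. \<Delta> = d^2"
  shows "group (norm_quotient \<Delta>)"
  unfolding norm_quotient_def by (rule normal.factorgroup_is_group[OF norm_group_normal[OF assms]])

lemma carrier_norm_quotient:
  "carrier (norm_quotient \<Delta>) = norm_residue \<Delta> ` (UNIV - {0})"
  by (auto simp: norm_quotient_def FactGroup_def RCOSETS_def norm_residue_def)

lemma norm_residue_mult:
  assumes "\<nexists>d. \<Delta> = d^2" and "a \<noteq> 0" "b \<noteq> 0"
  shows "norm_residue \<Delta> a \<otimes>\<^bsub>norm_quotient \<Delta>\<^esub> norm_residue \<Delta> b = norm_residue \<Delta> (a * b)"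
  using normal.rcos_sum[OF norm_group_normal[OF assms(1)], of a b] assms(2,3)
  by (simp add: norm_quotient_def norm_residue_def)

lemma norm_residue_eqI:
  assumes "\<nexists>d. \<Delta> = d^2" and "a \<noteq> 0" and "b \<in> norm_residue \<Delta> a"
  shows "norm_residue \<Delta> b = norm_residue \<Delta> a"
  using group.repr_independence[OF comm_group.axioms(2)[OF comm_group_mult_grp]
      _ _ normal_imp_subgroup[OF norm_group_normal[OF assms(1)]], of b a] assms(2,3)
  by (simp add: norm_residue_def)

lemma norm_residue_eq_one:
  assumes "\<nexists>d. \<Delta> = d^2" and "a \<in> norm_group \<Delta>"
  shows "norm_residue \<Delta> a = \<one>\<^bsub>norm_quotient \<Delta>\<^esub>"
  using group.coset_join2[of mult_grp a "norm_group \<Delta>"] assms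
    comm_group.axioms(2)[OF comm_group_mult_grp]
    normal_imp_subgroup[OF norm_group_normal[OF assms(1)]] norm_group_nonzero[OF assms]
  by (simp add: norm_residue_def norm_quotient_def)

lemma norm_quotient_exponent_two:
  assumes "\<nexists>d. \<Delta> = d^2" and "c \<in> carrier (norm_quotient \<Delta>)"
  shows "c [^]\<^bsub>norm_quotient \<Delta>\<^esub> (2::nat) = \<one>\<^bsub>norm_quotient \<Delta>\<^esub>"
proof -
  interpret group "norm_quotient \<Delta>" by (rule group_norm_quotient[OF assms(1)])
  obtain a where a: "a \<noteq> 0" "c = norm_residue \<Delta> a"
    using assms(2) by (auto simp: carrier_norm_quotient)
  have "c [^]\<^bsub>norm_quotient \<Delta>\<^esub> (2::nat) = norm_residue \<Delta> (a^2)"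
    using assms(2) norm_residue_mult[OF assms(1) a(1) a(1)]
    by (simp add: numeral_2_eq_2 a(2))
  then show ?thesis
    using norm_residue_eq_one[OF assms(1) square_in_norm_group[OF a(1)]] by simp
qed


section \<open>Orbits as sets of substituted forms\<close>

text \<open>The quotient by \<open>\<plusminus>1\<close> and the inverse in the action both disappear, since \<open>-1\<close> acts trivially
  and inversion permutes the matrices of determinant one.\<close>

lemma form_class_eq: "form_class Q = {bqf_subst Q B | B. det B = 1}"
proof -
  have carrier: "carrier PSL2 = {{mat 1, - mat 1} #>\<^bsub>SL2\<^esub> A | A. A \<in> carrier (SL2 :: ('a^2^2) monoid)}"
    by (auto simp: PSL2_def FactGroup_def RCOSETS_def)
  have "form_class Q = {sl_act A Q | A. det A = 1}"
    unfolding form_class_def orbit_def carrier using psl_act_coset[of _ Q]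
    by (auto simp: SL2_def; metis)
  also have "\<dots> = {bqf_subst Q B | B. det B = 1}"
  proof (intro equalityI subsetI)
    fix x assume "x \<in> {sl_act A Q | A. det A = 1}"
    then obtain A where A: "det A = 1" "x = bqf_subst Q (matrix_inv A)"
      by (auto simp: sl_act_def)
    have "det (matrix_inv A) = 1"
      using sl_inverse(1)[OF A(1)] A(1) by (metis det_mul det_I mult_1)
    with A show "x \<in> {bqf_subst Q B | B. det B = 1}" by blast
  next
    fix x assume "x \<in> {bqf_subst Q B | B. det B = 1}"
    then obtain B where B: "det B = 1" "x = bqf_subst Q B" by auto
    have "det (matrix_inv B) = 1"
      using sl_inverse(1)[OF B(1)] B(1) by (metis det_mul det_I mult_1)
    moreover from this have "matrix_inv (matrix_inv B) = B"
      by (rule sl_inverse_unique) (rule sl_inverse(2)[OF B(1)])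
    ultimately show "x \<in> {sl_act A Q | A. det A = 1}"
      using B(2) by (auto simp: sl_act_def intro!: exI[of _ "matrix_inv B"])
  qed
  finally show ?thesis .
qed

lemma Cl_eq: "Cl \<Delta> = form_class ` bqf_of_disc \<Delta>"
  by (auto simp: Cl_def orbits_def form_class_def)

lemma form_class_self: "Q \<in> form_class Q"
  unfolding form_class_eq using bqf_subst_one[of Q] by (metis (mono_tags, lifting) CollectI det_I)

lemma form_class_subst:
  fixes B :: "'a::field^2^2"
  assumes "det B = 1"
  shows "form_class (bqf_subst Q B) = form_class Q"
proof (intro equalityI subsetI)
  fix x assume "x \<in> form_class (bqf_subst Q B)"
  then obtain A where "det A = 1" "x = bqf_subst Q (B ** A)"
    by (auto simp: form_class_eq bqf_subst_mult)
  with assms show "x \<in> form_class Q" by (auto simp: form_class_eq det_mul)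
next
  fix x assume "x \<in> form_class Q"
  then obtain A where A: "det A = 1" "x = bqf_subst Q A" by (auto simp: form_class_eq)
  have "det (matrix_inv B) = 1"
    using sl_inverse(1)[OF assms] assms by (metis det_mul det_I mult_1)
  moreover have "x = bqf_subst (bqf_subst Q B) (matrix_inv B ** A)"
    using A(2) sl_inverse(1)[OF assms] by (simp add: bqf_subst_mult matrix_mul_assoc)
  ultimately show "x \<in> form_class (bqf_subst Q B)"
    using A(1) by (auto simp: form_class_eq det_mul)
qed

lemma form_class_disc:
  assumes "Q' \<in> form_class Q"
  shows "bqf_disc Q' = bqf_disc Q"
  using assms by (auto simp: form_class_eq bqf_disc_subst)

lemma form_class_eq_of_mem:
  assumes "Q' \<in> form_class Q"
  shows "form_class Q' = form_class Q"
proof -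
  obtain B where "det B = 1" "Q' = bqf_subst Q B" using assms by (auto simp: form_class_eq)
  then show ?thesis using form_class_subst by simp
qed

lemma Cl_cases:
  assumes "\<O> \<in> Cl \<Delta>" "Q \<in> \<O>"
  shows "bqf_disc Q = \<Delta>" "\<O> = form_class Q"
proof -
  obtain Q0 where Q0: "bqf_disc Q0 = \<Delta>" "\<O> = form_class Q0"
    using assms(1) by (auto simp: Cl_eq bqf_of_disc_def)
  show "bqf_disc Q = \<Delta>" using form_class_disc[of Q Q0] Q0 assms(2) by simp
  show "\<O> = form_class Q" using form_class_eq_of_mem[of Q Q0] Q0 assms(2) by simp
qed


section \<open>The values of a form\<close>

lemma two_neq_zero:
  assumes "CHAR('a::field) \<noteq> 2"
  shows "(2::'a) \<noteq> 0"
proof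
  assume "(2::'a) = 0"
  then have "CHAR('a) dvd 2" using of_nat_eq_0_iff_char_dvd[of 2, where 'a = 'a] by simp
  then have "CHAR('a) \<le> 2" "CHAR('a) \<noteq> 0" by (simp add: dvd_imp_le, intro notI) simp
  moreover have "CHAR('a) \<noteq> 1" using of_nat_CHAR[where 'a = 'a] by auto
  ultimately show False using assms by linarith
qed

lemma leading_coeff_neq_zero:
  assumes "\<nexists>d. bqf_disc (BQF l m r) = d^2"
  shows "l \<noteq> 0"
  using assms by auto

lemma axis_neq_zero: "axis 1 1 \<noteq> (0 :: 'a::field^2)"
  by (simp add: vec_eq_iff axis_def)

lemma bqf_eval_axis: "bqf_eval (BQF l m r) (axis 1 1) = l"
  by (simp add: axis_def)

lemma complete_square:
  fixes x y :: "'a::field"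
  assumes "(2::'a) \<noteq> 0" "l \<noteq> 0"
  shows "l * x^2 + m * x * y + r * y^2
    = ((x + m * (y / (2 * l)))^2 - bqf_disc (BQF l m r) * (y / (2 * l))^2) * l"
proof -
  define t where "t = y / (2 * l)"
  have y: "y = 2 * l * t" using assms by (simp add: t_def)
  show ?thesis
    unfolding t_def[symmetric] unfolding y by (simp add: power2_eq_square algebra_simps)
qed

text \<open>In the square \<open>Q(x, y) = l \<cdot> N(s + t sqrt \<Delta>)\<close> the pairs \<open>(x, y)\<close> and \<open>(s, t)\<close> determine each other
  linearly, so the values fill the whole coset and not merely a part of it. Injectivity of the
  value map depends on this.\<close>

lemma bqf_values_eq_norm_residue:
  fixes l m r :: "'a::field"
  assumes two: "(2::'a) \<noteq> 0" and nonsquare: "\<nexists>d. \<Delta> = d^2"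
    and disc: "bqf_disc (BQF l m r) = \<Delta>"
  shows "bqf_eval (BQF l m r) ` (UNIV - {0}) = norm_residue \<Delta> l"
proof (intro equalityI subsetI)
  have l: "l \<noteq> 0" using leading_coeff_neq_zero nonsquare disc by metis
  {
    fix a assume "a \<in> bqf_eval (BQF l m r) ` (UNIV - {0})"
    then obtain v where v: "v \<noteq> 0" "a = bqf_eval (BQF l m r) v" by auto
    define s where "s = v$1 + m * (v$2 / (2 * l))"
    define t where "t = v$2 / (2 * l)"
    have "(s, t) \<noteq> (0, 0)"
      using v(1) two l by (auto simp: s_def t_def vec_eq_iff forall_2)
    then have "s^2 - \<Delta> * t^2 \<in> norm_group \<Delta>" unfolding norm_group_iff by blast
    moreover have "a = (s^2 - \<Delta> * t^2) * l"
      using v(2) complete_square[OF two l, of "v$1" m "v$2" r] disc by (simp add: s_def t_def)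
    ultimately show "a \<in> norm_residue \<Delta> l"
      unfolding norm_residue_def r_coset_def by auto
  }
  {
    fix a assume "a \<in> norm_residue \<Delta> l"
    then obtain n where "n \<in> norm_group \<Delta>" "a = n * l"
      by (auto simp: norm_residue_def r_coset_def)
    then obtain s t where st: "(s, t) \<noteq> (0, 0)" "a = (s^2 - \<Delta> * t^2) * l"
      unfolding norm_group_iff by blast
    define v :: "'a^2" where "v = vector [s - m * t, 2 * l * t]"
    have "v \<noteq> 0"
      using st(1) two l by (auto simp: v_def vec_eq_iff forall_2)
    moreover have "a = bqf_eval (BQF l m r) v"
      using st(2) complete_square[OF two l, of "s - m * t" m "2 * l * t" r] disc two l
      by (simp add: v_def)
    ultimately show "a \<in> bqf_eval (BQF l m r) ` (UNIV - {0})" by auto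
  }
qed

lemma
  fixes Q :: "'a::field bqf"
  assumes two: "(2::'a) \<noteq> 0" and nonsquare: "\<nexists>d. \<Delta> = d^2"
    and disc: "bqf_disc Q = \<Delta>" and v: "v \<noteq> 0"
  shows bqf_eval_neq_zero: "bqf_eval Q v \<noteq> 0"
    and norm_residue_bqf_eval: "norm_residue \<Delta> (bqf_eval Q v) = bqf_eval Q ` (UNIV - {0})"
proof -
  obtain l m r where Q: "Q = BQF l m r" by (cases Q)
  have l: "l \<noteq> 0" using leading_coeff_neq_zero nonsquare disc Q by metis
  have vals: "bqf_eval Q ` (UNIV - {0}) = norm_residue \<Delta> l"
    using bqf_values_eq_norm_residue[OF two nonsquare] disc Q by blast
  have mem: "bqf_eval Q v \<in> norm_residue \<Delta> l"
    unfolding vals[symmetric] using v by blast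
  then show "bqf_eval Q v \<noteq> 0"
    using l norm_group_nonzero[OF nonsquare] by (auto simp: norm_residue_def r_coset_def)
  show "norm_residue \<Delta> (bqf_eval Q v) = bqf_eval Q ` (UNIV - {0})"
    unfolding vals by (rule norm_residue_eqI[OF nonsquare l mem])
qed

lemma bqf_values_subst:
  fixes B :: "'a::field^2^2"
  assumes "det B = 1"
  shows "bqf_eval (bqf_subst Q B) ` (UNIV - {0}) = bqf_eval Q ` (UNIV - {0})"
proof -
  have B: "B *v (matrix_inv B *v v) = v" "matrix_inv B *v (B *v v) = v" for v
    using sl_inverse[OF assms] by (simp_all add: matrix_vector_mul_assoc)
  have "(*v) B ` (UNIV - {0}) = UNIV - {0}"
  proof (intro equalityI subsetI)
    fix v assume "v \<in> (*v) B ` (UNIV - {0})"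
    then show "v \<in> UNIV - {0}"
      using B(2) by (metis Diff_iff UNIV_I imageE matrix_vector_mult_0_right singleton_iff)
  next
    fix v :: "'a^2" assume "v \<in> UNIV - {0}"
    then have "matrix_inv B *v v \<in> UNIV - {0}"
      using B(1)[of v] by (metis Diff_iff UNIV_I matrix_vector_mult_0_right singleton_iff)
    then show "v \<in> (*v) B ` (UNIV - {0})" using B(1)[of v] by (metis imageI)
  qed
  then have "bqf_eval Q ` (\<lambda>v. B *v v) ` (UNIV - {0}) = bqf_eval Q ` (UNIV - {0})" by simp
  then show ?thesis by (simp add: bqf_eval_subst image_image)
qed

lemma value_class_eq:
  fixes Q :: "'a::field bqf"
  assumes two: "(2::'a) \<noteq> 0" and nonsquare: "\<nexists>d. \<Delta> = d^2" and disc: "bqf_disc Q = \<Delta>"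
  shows "value_class \<Delta> (form_class Q) = bqf_eval Q ` (UNIV - {0})"
proof -
  have *: "norm_residue \<Delta> (bqf_eval Q' v) = bqf_eval Q ` (UNIV - {0})"
    if "Q' \<in> form_class Q" "v \<noteq> 0" for Q' v
  proof -
    have "bqf_disc Q' = \<Delta>" using form_class_disc[OF that(1)] disc by simp
    then have "norm_residue \<Delta> (bqf_eval Q' v) = bqf_eval Q' ` (UNIV - {0})"
      using norm_residue_bqf_eval[OF two nonsquare] that(2) by blast
    also have "\<dots> = bqf_eval Q ` (UNIV - {0})"
      using that(1) bqf_values_subst[of _ Q] unfolding form_class_eq by blast
    finally show ?thesis .
  qed
  have "{norm_residue \<Delta> (bqf_eval Q' v) | Q' v. Q' \<in> form_class Q \<and> v \<noteq> 0}
    = {bqf_eval Q ` (UNIV - {0})}" (is "?S = {?V}")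
  proof (intro equalityI subsetI)
    show "x \<in> {?V}" if "x \<in> ?S" for x using that * by blast
    show "x \<in> ?S" if "x \<in> {?V}" for x
      using that *[OF form_class_self axis_neq_zero] form_class_self axis_neq_zero by blast
  qed
  then show ?thesis by (simp add: value_class_def)
qed

lemma value_class_eval:
  fixes \<Delta> :: "'a::field"
  assumes "(2::'a) \<noteq> 0" and "\<nexists>d. \<Delta> = d^2" and "\<O> \<in> Cl \<Delta>" "Q \<in> \<O>" "v \<noteq> 0"
  shows "value_class \<Delta> \<O> = norm_residue \<Delta> (bqf_eval Q v)"
  using Cl_cases[OF assms(3,4)] value_class_eq[OF assms(1,2), of Q]
    norm_residue_bqf_eval[OF assms(1,2) _ assms(5), of Q] by simp

lemma value_class_closed:
  fixes \<Delta> :: "'a::field"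
  assumes "(2::'a) \<noteq> 0" and "\<nexists>d. \<Delta> = d^2" and "\<O> \<in> Cl \<Delta>"
  shows "value_class \<Delta> \<O> \<in> carrier (norm_quotient \<Delta>)"
proof -
  obtain Q where Q: "Q \<in> \<O>" using assms(3) form_class_self by (auto simp: Cl_eq)
  show ?thesis
    using value_class_eval[OF assms Q axis_neq_zero]
      bqf_eval_neq_zero[OF assms(1,2) Cl_cases(1)[OF assms(3) Q] axis_neq_zero]
    by (auto simp: carrier_norm_quotient)
qed


section \<open>Forms with the same values are equivalent\<close>

lemma vector_completes_to_det_one:
  fixes v :: "'a::field^2"
  assumes "v \<noteq> 0"
  obtains B :: "'a^2^2" where "det B = 1" "B$1$1 = v$1" "B$2$1 = v$2"
proof (cases "v$1 = 0")
  case True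
  then have "v$2 \<noteq> 0" using assms by (auto simp: vec_eq_iff forall_2)
  with True show ?thesis
    by (intro that[of "vector [vector [v$1, - 1 / v$2], vector [v$2, 0]]"]) (auto simp: det_2)
next
  case False
  then show ?thesis
    by (intro that[of "vector [vector [v$1, 0], vector [v$2, 1 / v$1]]"]) (auto simp: det_2)
qed

text \<open>The shear \<open>x \<mapsto> x + k y\<close> fixes the leading coefficient \<open>l\<close> and adds \<open>2 l k\<close> to the middle
  one, which can so be given any value. The discriminant then determines the last coefficient.\<close>

lemma form_class_eq_of_leading_coeff:
  fixes l :: "'a::field"
  assumes two: "(2::'a) \<noteq> 0" and l: "l \<noteq> 0"
    and disc: "bqf_disc (BQF l m r) = bqf_disc (BQF l m' r')"
  shows "form_class (BQF l m r) = form_class (BQF l m' r')"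
proof -
  define k where "k = (m' - m) / (2 * l)"
  have m': "m' = m + 2 * l * k" using two l by (simp add: k_def)
  define B :: "'a^2^2" where "B = vector [vector [1, k], vector [0, 1]]"
  have "(2 * 2) * l * (l * k^2 + m * k + r - r') = 0"
    using disc unfolding m' by (simp add: power2_eq_square algebra_simps)
  then have "l * k^2 + m * k + r - r' = 0" using two l by (metis mult_eq_0_iff)
  then have "r' = l * k^2 + m * k + r" by simp
  then have "bqf_subst (BQF l m r) B = BQF l m' r'" by (simp add: B_def m')
  moreover have "det B = 1" by (simp add: B_def det_2)
  ultimately show ?thesis using form_class_subst[of B "BQF l m r"] by simp
qed

lemma form_class_eqI:
  fixes Q Q' :: "'a::field bqf"
  assumes two: "(2::'a) \<noteq> 0" and nonsquare: "\<nexists>d. \<Delta> = d^2"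
    and disc: "bqf_disc Q = \<Delta>" "bqf_disc Q' = \<Delta>"
    and vals: "bqf_eval Q ` (UNIV - {0}) = bqf_eval Q' ` (UNIV - {0})"
  shows "form_class Q = form_class Q'"
proof -
  obtain l m r where Q': "Q' = BQF l m r" by (cases Q')
  have "l \<in> bqf_eval Q' ` (UNIV - {0})"
    using axis_neq_zero bqf_eval_axis Q' by (intro image_eqI[of _ _ "axis 1 1"]) auto
  then obtain v where v: "v \<noteq> 0" "bqf_eval Q v = l" unfolding vals[symmetric] by auto
  obtain B :: "'a^2^2" where B: "det B = 1" "B$1$1 = v$1" "B$2$1 = v$2"
    using vector_completes_to_det_one[OF v(1)] .
  obtain m' r' where QB: "bqf_subst Q B = BQF l m' r'"
    using v(2) B(2,3) by (cases Q) auto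
  have "bqf_disc (BQF l m' r') = bqf_disc (BQF l m r)"
    using disc B(1) bqf_disc_subst[of Q B] by (simp add: QB Q')
  moreover have "l \<noteq> 0" using leading_coeff_neq_zero nonsquare disc(2) Q' by metis
  ultimately have "form_class (bqf_subst Q B) = form_class Q'"
    unfolding QB Q' by (intro form_class_eq_of_leading_coeff[OF two])
  then show ?thesis using form_class_subst[OF B(1)] by simp
qed


section \<open>The value map is a bijection onto the quotient\<close>

lemma value_class_inj:
  fixes \<Delta> :: "'a::field"
  assumes "(2::'a) \<noteq> 0" and "\<nexists>d. \<Delta> = d^2"
  shows "inj_on (value_class \<Delta>) (Cl \<Delta>)"
proof (rule inj_onI)
  fix \<A> \<B> assume "\<A> \<in> Cl \<Delta>" "\<B> \<in> Cl \<Delta>" and eq: "value_class \<Delta> \<A> = value_class \<Delta> \<B>"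
  then obtain Q Q' where "bqf_disc Q = \<Delta>" "\<A> = form_class Q" "bqf_disc Q' = \<Delta>" "\<B> = form_class Q'"
    by (auto simp: Cl_eq bqf_of_disc_def)
  then show "\<A> = \<B>"
    using eq value_class_eq[OF assms] form_class_eqI[OF assms, of Q Q'] by simp
qed

lemma diagonal_form_disc:
  fixes a :: "'a::field"
  assumes "(2::'a) \<noteq> 0" "a \<noteq> 0"
  shows "bqf_disc (BQF a 0 (- (\<Delta> / (4 * a)))) = \<Delta>"
proof -
  have "(4::'a) = 2 * 2" by simp
  then have "(4::'a) \<noteq> 0" using assms(1) by (metis mult_eq_0_iff)
  with assms(2) show ?thesis by simp
qed

lemma value_class_diagonal_form:
  fixes a :: "'a::field"
  assumes "(2::'a) \<noteq> 0" and "\<nexists>d. \<Delta> = d^2" and "a \<noteq> 0"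
  shows "form_class (BQF a 0 (- (\<Delta> / (4 * a)))) \<in> Cl \<Delta>"
    and "value_class \<Delta> (form_class (BQF a 0 (- (\<Delta> / (4 * a))))) = norm_residue \<Delta> a"
proof -
  let ?Q = "BQF a 0 (- (\<Delta> / (4 * a)))"
  show Cl: "form_class ?Q \<in> Cl \<Delta>"
    unfolding Cl_eq bqf_of_disc_def using diagonal_form_disc[OF assms(1,3)] by blast
  show "value_class \<Delta> (form_class ?Q) = norm_residue \<Delta> a"
    using value_class_eval[OF assms(1,2) Cl form_class_self axis_neq_zero]
    unfolding bqf_eval_axis .
qed

lemma value_class_bij:
  fixes \<Delta> :: "'a::field"
  assumes "(2::'a) \<noteq> 0" and "\<nexists>d. \<Delta> = d^2"
  shows "bij_betw (value_class \<Delta>) (Cl \<Delta>) (carrier (norm_quotient \<Delta>))"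
  unfolding bij_betw_def
proof
  show "inj_on (value_class \<Delta>) (Cl \<Delta>)" by (rule value_class_inj[OF assms])
  show "value_class \<Delta> ` Cl \<Delta> = carrier (norm_quotient \<Delta>)"
  proof (intro equalityI subsetI)
    fix c assume "c \<in> carrier (norm_quotient \<Delta>)"
    then obtain a where "a \<noteq> 0" "c = norm_residue \<Delta> a" by (auto simp: carrier_norm_quotient)
    then show "c \<in> value_class \<Delta> ` Cl \<Delta>"
      using value_class_diagonal_form[OF assms \<open>a \<noteq> 0\<close>] by (metis imageI)
  qed (use value_class_closed[OF assms] in auto)
qed

lemma norm_form_class:
  fixes \<Delta> :: "'a::field"
  assumes "(2::'a) \<noteq> 0" and "\<nexists>d. \<Delta> = d^2"
  shows "form_class (norm_form \<Delta>) \<in> Cl \<Delta>"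
    and "value_class \<Delta> (form_class (norm_form \<Delta>)) = \<one>\<^bsub>norm_quotient \<Delta>\<^esub>"
  using value_class_diagonal_form[OF assms, of 1] square_in_norm_group[of 1 \<Delta>]
    norm_residue_eq_one[OF assms(2), of 1] by (simp_all add: norm_form_def)


section \<open>Composition of orbits\<close>

lemma is_product_iff:
  fixes \<Delta> :: "'a::field"
  assumes two: "(2::'a) \<noteq> 0" and nonsquare: "\<nexists>d. \<Delta> = d^2"
    and "\<A> \<in> Cl \<Delta>" "\<B> \<in> Cl \<Delta>" "\<C> \<in> Cl \<Delta>"
  shows "is_product \<Delta> \<A> \<B> \<C> \<longleftrightarrow>
    value_class \<Delta> \<C> = value_class \<Delta> \<A> \<otimes>\<^bsub>norm_quotient \<Delta>\<^esub> value_class \<Delta> \<B>"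
    (is "_ \<longleftrightarrow> ?R")
proof -
  have *: "norm_residue \<Delta> (bqf_eval Q w) = norm_residue \<Delta> (bqf_eval Qa u * bqf_eval Qb v) \<longleftrightarrow> ?R"
    if "Qa \<in> \<A>" "Qb \<in> \<B>" "Q \<in> \<C>" "u \<noteq> 0" "v \<noteq> 0" "w \<noteq> 0" for Qa Qb Q u v w
  proof -
    have "bqf_eval Qa u \<noteq> 0" "bqf_eval Qb v \<noteq> 0"
      using bqf_eval_neq_zero[OF two nonsquare] Cl_cases(1) assms(3,4) that by blast+
    then show ?thesis
      using norm_residue_mult[OF nonsquare] assms(3-5) that
        value_class_eval[OF two nonsquare, of \<A> Qa u] value_class_eval[OF two nonsquare, of \<B> Qb v]
        value_class_eval[OF two nonsquare, of \<C> Q w] by simp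
  qed
  \<comment> \<open>Orbits are nonempty, so the universally quantified condition is not vacuous.\<close>
  obtain Qa Qb Q where "Qa \<in> \<A>" "Qb \<in> \<B>" "Q \<in> \<C>"
    using assms(3-5) form_class_self unfolding Cl_eq by blast
  then have "?R" if "is_product \<Delta> \<A> \<B> \<C>"
    using that *[OF _ _ _ axis_neq_zero axis_neq_zero axis_neq_zero] axis_neq_zero
    unfolding is_product_def by meson
  moreover have "is_product \<Delta> \<A> \<B> \<C>" if "?R"
    unfolding is_product_def
  proof (intro ballI allI impI)
    fix Qa Qb Q :: "'a bqf" and u v w :: "'a^2"
    assume "Qa \<in> \<A>" "Qb \<in> \<B>" "Q \<in> \<C>" "u \<noteq> 0" "v \<noteq> 0" "w \<noteq> 0"
    from *[OF this] that
    show "norm_residue \<Delta> (bqf_eval Q w) = norm_residue \<Delta> (bqf_eval Qa u * bqf_eval Qb v)" by simp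
  qed
  ultimately show ?thesis by blast
qed

lemma ex1_is_product:
  fixes \<Delta> :: "'a::field"
  assumes two: "(2::'a) \<noteq> 0" and nonsquare: "\<nexists>d. \<Delta> = d^2"
    and AB: "\<A> \<in> Cl \<Delta>" "\<B> \<in> Cl \<Delta>"
  shows "\<exists>!\<C>. \<C> \<in> Cl \<Delta> \<and> is_product \<Delta> \<A> \<B> \<C>"
proof -
  interpret group "norm_quotient \<Delta>" by (rule group_norm_quotient[OF nonsquare])
  have "value_class \<Delta> \<A> \<otimes>\<^bsub>norm_quotient \<Delta>\<^esub> value_class \<Delta> \<B> \<in> carrier (norm_quotient \<Delta>)"
    using value_class_closed[OF two nonsquare] AB by simp
  then obtain \<C> where \<C>: "\<C> \<in> Cl \<Delta>"
      "value_class \<Delta> \<C> = value_class \<Delta> \<A> \<otimes>\<^bsub>norm_quotient \<Delta>\<^esub> value_class \<Delta> \<B>"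
    using bij_betw_imp_surj_on[OF value_class_bij[OF two nonsquare]] by (metis imageE)
  show ?thesis
  proof (rule ex1I[of _ \<C>])
    show "\<C> \<in> Cl \<Delta> \<and> is_product \<Delta> \<A> \<B> \<C>"
      using \<C> is_product_iff[OF two nonsquare AB] by simp
    fix \<D> assume D: "\<D> \<in> Cl \<Delta> \<and> is_product \<Delta> \<A> \<B> \<D>"
    then have "value_class \<Delta> \<D> = value_class \<Delta> \<C>"
      using \<C>(2) is_product_iff[OF two nonsquare AB, of \<D>] by simp
    then show "\<D> = \<C>"
      using inj_onD[OF value_class_inj[OF two nonsquare]] D \<C>(1) by blast
  qed
qed

lemma Cl_mult:
  fixes \<Delta> :: "'a::field"
  assumes two: "(2::'a) \<noteq> 0" and nonsquare: "\<nexists>d. \<Delta> = d^2"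
    and AB: "\<A> \<in> Cl \<Delta>" "\<B> \<in> Cl \<Delta>"
  shows "\<A> \<otimes>\<^bsub>Cl_group \<Delta>\<^esub> \<B> \<in> Cl \<Delta>"
    and "value_class \<Delta> (\<A> \<otimes>\<^bsub>Cl_group \<Delta>\<^esub> \<B>)
      = value_class \<Delta> \<A> \<otimes>\<^bsub>norm_quotient \<Delta>\<^esub> value_class \<Delta> \<B>"
proof -
  let ?P = "\<A> \<otimes>\<^bsub>Cl_group \<Delta>\<^esub> \<B>"
  have "?P \<in> Cl \<Delta> \<and> is_product \<Delta> \<A> \<B> ?P"
    using theI'[OF ex1_is_product[OF assms]] by (simp add: Cl_group_def)
  then show "?P \<in> Cl \<Delta>"
    and "value_class \<Delta> ?P = value_class \<Delta> \<A> \<otimes>\<^bsub>norm_quotient \<Delta>\<^esub> value_class \<Delta> \<B>"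
    using is_product_iff[OF assms] by blast+
qed

lemma group_transport:
  fixes G (structure) and H (structure)
  assumes "group H" and bij: "bij_betw f (carrier G) (carrier H)"
    and closed: "\<And>x y. x \<in> carrier G \<Longrightarrow> y \<in> carrier G \<Longrightarrow> x \<otimes> y \<in> carrier G"
    and mult: "\<And>x y. x \<in> carrier G \<Longrightarrow> y \<in> carrier G \<Longrightarrow> f (x \<otimes> y) = f x \<otimes>\<^bsub>H\<^esub> f y"
    and one: "\<one> \<in> carrier G" "f \<one> = \<one>\<^bsub>H\<^esub>"
  shows "group G"
proof -
  interpret H: group H by fact
  have f: "f x \<in> carrier H" if "x \<in> carrier G" for x
    using bij that by (rule bij_betwE[THEN bspec])
  have eqI: "x = y" if "x \<in> carrier G" "y \<in> carrier G" "f x = f y" for x y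
    using bij that by (auto simp: bij_betw_def dest: inj_onD)
  show ?thesis
  proof (rule groupI)
    fix x assume x: "x \<in> carrier G"
    show "\<one> \<otimes> x = x" using x by (intro eqI) (auto simp: closed mult one f)
    obtain y where "y \<in> carrier G" "f y = inv\<^bsub>H\<^esub> (f x)"
      using bij H.inv_closed[OF f[OF x]] by (metis bij_betw_def imageE)
    with x show "\<exists>y\<in>carrier G. y \<otimes> x = \<one>"
      by (intro bexI[of _ y] eqI) (auto simp: closed mult one f)
  next
    fix x y z assume "x \<in> carrier G" "y \<in> carrier G" "z \<in> carrier G"
    then show "x \<otimes> y \<otimes> z = x \<otimes> (y \<otimes> z)"
      by (intro eqI) (auto simp: closed mult f H.m_assoc)
  qed (auto simp: closed one)
qed

lemma group_Cl_group:
  fixes \<Delta> :: "'a::field"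
  assumes "(2::'a) \<noteq> 0" and "\<nexists>d. \<Delta> = d^2"
  shows "group (Cl_group \<Delta>)"
proof -
  have Cl: "carrier (Cl_group \<Delta>) = Cl \<Delta>" "\<one>\<^bsub>Cl_group \<Delta>\<^esub> = form_class (norm_form \<Delta>)"
    by (simp_all add: Cl_group_def)
  show ?thesis
    by (rule group_transport[OF group_norm_quotient[OF assms(2)], of "value_class \<Delta>"])
      (simp_all add: Cl value_class_bij[OF assms] Cl_mult[OF assms] norm_form_class[OF assms])
qed

lemma value_class_hom:
  fixes \<Delta> :: "'a::field"
  assumes "(2::'a) \<noteq> 0" and "\<nexists>d. \<Delta> = d^2"
  shows "value_class \<Delta> \<in> hom (Cl_group \<Delta>) (norm_quotient \<Delta>)"
proof (rule homI)
  have Cl: "carrier (Cl_group \<Delta>) = Cl \<Delta>" by (simp add: Cl_group_def)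
  show "value_class \<Delta> \<A> \<in> carrier (norm_quotient \<Delta>)" if "\<A> \<in> carrier (Cl_group \<Delta>)" for \<A>
    using that value_class_closed[OF assms] by (simp add: Cl)
  show "value_class \<Delta> (\<A> \<otimes>\<^bsub>Cl_group \<Delta>\<^esub> \<B>)
      = value_class \<Delta> \<A> \<otimes>\<^bsub>norm_quotient \<Delta>\<^esub> value_class \<Delta> \<B>"
    if "\<A> \<in> carrier (Cl_group \<Delta>)" "\<B> \<in> carrier (Cl_group \<Delta>)" for \<A> \<B>
    using that Cl_mult(2)[OF assms] by (simp add: Cl)
qed

theorem mainTheorem3:
  fixes \<Delta> :: "'a::field"
  assumes char: "CHAR('a) \<noteq> 2"
    and nonsquare: "\<nexists>d. \<Delta> = d^2"
  shows
    "norm_group \<Delta> \<lhd> mult_grp \<and>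
     group (norm_quotient \<Delta>) \<and>
     (\<forall>c \<in> carrier (norm_quotient \<Delta>). c [^]\<^bsub>norm_quotient \<Delta>\<^esub> (2::nat) = \<one>\<^bsub>norm_quotient \<Delta>\<^esub>) \<and>
     (\<forall>\<O> \<in> Cl \<Delta>. \<forall>Q \<in> \<O>. \<forall>v. v \<noteq> 0 \<longrightarrow>
        bqf_eval Q v \<noteq> 0 \<and> value_class \<Delta> \<O> = norm_residue \<Delta> (bqf_eval Q v)) \<and>
     inj_on (value_class \<Delta>) (Cl \<Delta>) \<and>
     form_class (norm_form \<Delta>) \<in> Cl \<Delta> \<and>
     value_class \<Delta> (form_class (norm_form \<Delta>)) = \<one>\<^bsub>norm_quotient \<Delta>\<^esub> \<and>
     (\<forall>\<A> \<in> Cl \<Delta>. \<forall>\<B> \<in> Cl \<Delta>. \<exists>!\<C>. \<C> \<in> Cl \<Delta> \<and> is_product \<Delta> \<A> \<B> \<C>) \<and>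
     group (Cl_group \<Delta>) \<and>
     value_class \<Delta> \<in> hom (Cl_group \<Delta>) (norm_quotient \<Delta>)"
proof (intro conjI)
  note two = two_neq_zero[OF char]
  show "norm_group \<Delta> \<lhd> mult_grp" by (rule norm_group_normal[OF nonsquare])
  show "group (norm_quotient \<Delta>)" by (rule group_norm_quotient[OF nonsquare])
  show "\<forall>c \<in> carrier (norm_quotient \<Delta>).
      c [^]\<^bsub>norm_quotient \<Delta>\<^esub> (2::nat) = \<one>\<^bsub>norm_quotient \<Delta>\<^esub>"
    by (intro ballI norm_quotient_exponent_two[OF nonsquare])
  show "\<forall>\<O> \<in> Cl \<Delta>. \<forall>Q \<in> \<O>. \<forall>v. v \<noteq> 0 \<longrightarrow>
      bqf_eval Q v \<noteq> 0 \<and> value_class \<Delta> \<O> = norm_residue \<Delta> (bqf_eval Q v)"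
    using Cl_cases(1) bqf_eval_neq_zero[OF two nonsquare] value_class_eval[OF two nonsquare]
    by blast
  show "inj_on (value_class \<Delta>) (Cl \<Delta>)" by (rule value_class_inj[OF two nonsquare])
  show "form_class (norm_form \<Delta>) \<in> Cl \<Delta>" by (rule norm_form_class(1)[OF two nonsquare])
  show "value_class \<Delta> (form_class (norm_form \<Delta>)) = \<one>\<^bsub>norm_quotient \<Delta>\<^esub>"
    by (rule norm_form_class(2)[OF two nonsquare])
  show "\<forall>\<A> \<in> Cl \<Delta>. \<forall>\<B> \<in> Cl \<Delta>. \<exists>!\<C>. \<C> \<in> Cl \<Delta> \<and> is_product \<Delta> \<A> \<B> \<C>"
    by (intro ballI ex1_is_product[OF two nonsquare])
  show "group (Cl_group \<Delta>)" by (rule group_Cl_group[OF two nonsquare])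
  show "value_class \<Delta> \<in> hom (Cl_group \<Delta>) (norm_quotient \<Delta>)"
    by (rule value_class_hom[OF two nonsquare])
qed

end
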